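(* Let $0 \le p \le 1$ and let $n$ be even. Inserting the pairs sequence $2,1,4,3,6,5,\ldots,n,n-1$ into an initially empty binary search tree, applying \textsc{RebalanceZigZag} after each insertion, results in a binary search tree whose expected average node depth is $\Theta(n)$.
   Context: Each new element is first placed as a new leaf $v$ at its standard unbalanced BST position, and then \textsc{RebalanceZigZag}$(v)$ is applied: while $v$ has a parent and an independent coin flip shows tail (tail has probability $p$, head probability $1-p$), set $v\gets$ parent of $v$. Afterwards, if $v$ has a parent and a grandparent: if $v$ and its parent are both left children or both right children, rotate the parent of $v$ up once; otherwise rotate $v$ up twice. ("Rotating $x$ up" is the standard single rotation at the parent of $x$ that moves $x$ one level up.) The depth of a node is the number of edges from it to the root; the average node depth is the sum of depths of all $n$ nodes divided by $n$. Expectation is over the coin flips. *)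

theory Defs
  imports "HOL-Library.Tree" "HOL-Library.Landau_Symbols" "HOL-Probability.Probability"
begin

text \<open>
  A node \<open>v\<close> of a tree is represented by a zipper: the subtree rooted at \<open>v\<close> and the
  path from \<open>v\<close> to the root, innermost step first. The step \<open>LeftOf y c\<close> says that the current
  subtree is the left child of a node with key \<open>y\<close> and right subtree \<open>c\<close>; the step
  \<open>RightOf a y\<close> says that it is the right child of a node with left subtree \<open>a\<close> and key \<open>y\<close>.
  The root is the node with empty path.
\<close>

datatype 'a step = LeftOf 'a "'a tree" | RightOf "'a tree" 'a

type_synonym 'a loc = "'a tree \<times> 'a step list"

fun plug :: "'a step \<Rightarrow> 'a tree \<Rightarrow> 'a tree" where
  "plug (LeftOf y c) t = Node t y c"
| "plug (RightOf a y) t = Node a y t"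

fun parent :: "'a loc \<Rightarrow> 'a loc" where
  "parent (t, s # ss) = (plug s t, ss)"
| "parent (t, []) = (t, [])"

fun whole_tree :: "'a loc \<Rightarrow> 'a tree" where
  "whole_tree (t, []) = t"
| "whole_tree (t, s # ss) = whole_tree (plug s t, ss)"

text \<open>The result is the position of the same node \<open>x\<close>, one level higher.\<close>

fun rotate_up :: "'a loc \<Rightarrow> 'a loc" where
  "rotate_up (Node a x b, LeftOf y c # ss) = (Node a x (Node b y c), ss)"
| "rotate_up (Node b x c, RightOf a y # ss) = (Node (Node a y b) x c, ss)"
| "rotate_up v = v"

text \<open>
  The result is the position of the new leaf. Keys are assumed not to be in the tree already.
\<close>

fun insert_leaf :: "'a::linorder \<Rightarrow> 'a loc \<Rightarrow> 'a loc" where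
  "insert_leaf x (Leaf, ss) = (Node Leaf x Leaf, ss)"
| "insert_leaf x (Node l y r, ss) =
     (if x < y then insert_leaf x (l, LeftOf y r # ss) else insert_leaf x (r, RightOf l y # ss))"

text \<open>The coin shows tail with probability \<open>p\<close>; \<open>True\<close> stands for tail.\<close>

function climb :: "real \<Rightarrow> 'a loc \<Rightarrow> 'a loc pmf" where
  "climb p (t, []) = return_pmf (t, [])"
| "climb p (t, s # ss) =
     bernoulli_pmf p \<bind>
       (\<lambda>tail. if tail then climb p (parent (t, s # ss)) else return_pmf (t, s # ss))"
  by pat_completeness auto
termination by (relation "Wellfounded.measure (\<lambda>(p, t, ss). length ss)") auto

fun zigzag :: "'a loc \<Rightarrow> 'a loc" where
  "zigzag (t, LeftOf y c # LeftOf z d # ss) = rotate_up (parent (t, LeftOf y c # LeftOf z d # ss))"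
| "zigzag (t, RightOf a y # RightOf b z # ss) = rotate_up (parent (t, RightOf a y # RightOf b z # ss))"
| "zigzag (t, LeftOf y c # RightOf b z # ss) = rotate_up (rotate_up (t, LeftOf y c # RightOf b z # ss))"
| "zigzag (t, RightOf a y # LeftOf z d # ss) = rotate_up (rotate_up (t, RightOf a y # LeftOf z d # ss))"
| "zigzag v = v"

definition rebalance_zigzag :: "real \<Rightarrow> 'a loc \<Rightarrow> 'a tree pmf" where
  "rebalance_zigzag p v = map_pmf (\<lambda>w. whole_tree (zigzag w)) (climb p v)"

definition insert_zigzag :: "real \<Rightarrow> 'a::linorder \<Rightarrow> 'a tree \<Rightarrow> 'a tree pmf" where
  "insert_zigzag p x t = rebalance_zigzag p (insert_leaf x (t, []))"

fun inserts_zigzag :: "real \<Rightarrow> 'a::linorder list \<Rightarrow> 'a tree \<Rightarrow> 'a tree pmf" where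
  "inserts_zigzag p [] t = return_pmf t"
| "inserts_zigzag p (x # xs) t = insert_zigzag p x t \<bind> inserts_zigzag p xs"

definition pairs_seq :: "nat \<Rightarrow> nat list" where
  "pairs_seq n = concat (map (\<lambda>i. [2 * i + 2, 2 * i + 1]) [0..<n div 2])"

definition pairs_tree :: "real \<Rightarrow> nat \<Rightarrow> nat tree pmf" where
  "pairs_tree p n = inserts_zigzag p (pairs_seq n) Leaf"

text \<open>The depths of all nodes, listed in symmetric order.\<close>

fun depths :: "'a tree \<Rightarrow> nat list" where
  "depths Leaf = []"
| "depths (Node l x r) = map Suc (depths l) @ 0 # map Suc (depths r)"

definition avg_depth :: "'a tree \<Rightarrow> real" where
  "avg_depth t = real (sum_list (depths t)) / real (size t)"

lemma length_depths [simp]: "length (depths t) = size t"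
  by (induction t) auto

lemma sum_list_depths: "sum_list (depths t) = ipl t"
proof -
  have *: "sum_list (map Suc xs) = sum_list xs + length xs" for xs
    by (induction xs) auto
  show ?thesis by (induction t) (auto simp: *)
qed

lemma whole_tree_parent [simp]: "whole_tree (parent v) = whole_tree v"
  by (cases v rule: parent.cases) auto

lemma inorder_whole_tree_cong:
  "inorder t = inorder u \<Longrightarrow> inorder (whole_tree (t, ss)) = inorder (whole_tree (u, ss))"
proof (induction ss arbitrary: t u)
  case (Cons s ss)
  then show ?case by (cases s) auto
qed auto

lemma inorder_rotate_up [simp]: "inorder (whole_tree (rotate_up v)) = inorder (whole_tree v)"
  by (cases v rule: rotate_up.cases) (auto intro!: inorder_whole_tree_cong)

lemma inorder_zigzag [simp]: "inorder (whole_tree (zigzag v)) = inorder (whole_tree v)"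
  by (cases v rule: zigzag.cases) (simp_all del: parent.simps whole_tree.simps)

lemma whole_tree_climb: "w \<in> set_pmf (climb p v) \<Longrightarrow> whole_tree w = whole_tree v"
  by (induction p v rule: climb.induct) (auto split: if_splits)

lemma inorder_insert_zigzag:
  "u \<in> set_pmf (insert_zigzag p x t) \<Longrightarrow> inorder u = inorder (whole_tree (insert_leaf x (t, [])))"
  by (auto simp: insert_zigzag_def rebalance_zigzag_def dest!: whole_tree_climb)

end

theory Submission
  imports Defs
begin

text \<open>
  All rotations take place on the right spine. After each pair of insertions, let \<open>r\<close> be the
  number of nodes on the right spine and \<open>l\<close> the number of nodes on the left spine below the
  root. Once \<open>r \<ge> 2\<close>, every pair increases the expectation of \<open>p * l - (1 - p) * r\<close> by
  exactly \<open>p * (1 - p)\<close>: the probability of a rotation at the root is proportional to that of the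
  right spine failing to shrink, so the dependence on \<open>r\<close> cancels. Hence \<open>l\<close> has linear
  expectation for \<open>0 < p < 1\<close>. For \<open>p = 0\<close> the process is deterministic with \<open>r = 2\<close> and
  \<open>l\<close> growing, and for \<open>p = 1\<close> no rotation happens and \<open>r\<close> grows. So the expected height \<open>h\<close>
  is linear, and the internal path length is at least \<open>h * (h - 1) / 2\<close>; convexity of this bound
  turns the expected height into an expected path length.
\<close>

section \<open>Expectations over finitely supported distributions\<close>

lemma expectation_coin:
  fixes h :: "'a \<Rightarrow> real"
  assumes "0 \<le> p" "p \<le> 1" "finite (set_pmf P)" "finite (set_pmf Q)"
  shows "measure_pmf.expectation (bernoulli_pmf p \<bind> (\<lambda>b. if b then P else Q)) h =
    p * measure_pmf.expectation P h + (1 - p) * measure_pmf.expectation Q h"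
  using assms by (subst pmf_expectation_bind[where A = UNIV]) (auto simp: UNIV_bool)

text \<open>Tower property as an inequality: a bound on every conditional expectation passes to the
  mixture. This is the induction step of the drift argument.\<close>

lemma expectation_bind_ge:
  fixes h :: "'b \<Rightarrow> real"
  assumes "finite (set_pmf P)" "\<And>x. x \<in> set_pmf P \<Longrightarrow> finite (set_pmf (f x))"
    and "\<And>x. x \<in> set_pmf P \<Longrightarrow> g x \<le> measure_pmf.expectation (f x) h"
  shows "measure_pmf.expectation P g \<le> measure_pmf.expectation (P \<bind> f) h"
proof -
  have "measure_pmf.expectation P g = (\<Sum>x\<in>set_pmf P. pmf P x * g x)"
    using assms(1) by (subst integral_measure_pmf[where A = "set_pmf P"]) auto
  also have "\<dots> \<le> (\<Sum>x\<in>set_pmf P. pmf P x * measure_pmf.expectation (f x) h)"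
    by (intro sum_mono mult_left_mono assms) auto
  also have "\<dots> = measure_pmf.expectation (P \<bind> f) h"
    using assms by (subst pmf_expectation_bind[where A = "set_pmf P"]) auto
  finally show ?thesis .
qed

lemma expectation_mono_finite:
  fixes g h :: "'a \<Rightarrow> real"
  assumes "finite (set_pmf P)" "\<And>x. x \<in> set_pmf P \<Longrightarrow> g x \<le> h x"
  shows "measure_pmf.expectation P g \<le> measure_pmf.expectation P h"
  using assms
  by (intro integral_mono_AE integrable_measure_pmf_finite) (auto simp: AE_measure_pmf_iff)

lemma expectation_ge_const:
  fixes h :: "'a \<Rightarrow> real"
  assumes "finite (set_pmf P)" "\<And>x. x \<in> set_pmf P \<Longrightarrow> c \<le> h x"
  shows "c \<le> measure_pmf.expectation P h"
  using expectation_mono_finite[of P "\<lambda>_. c" h] assms by simp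

lemma expectation_add_const:
  fixes h :: "'a \<Rightarrow> real"
  assumes "finite (set_pmf P)"
  shows "measure_pmf.expectation P (\<lambda>x. h x + c) = measure_pmf.expectation P h + c"
  using assms by (subst Bochner_Integration.integral_add)
    (auto intro: integrable_measure_pmf_finite)

section \<open>Search trees, heights and internal path lengths\<close>

fun bst_insert :: "'a::linorder \<Rightarrow> 'a tree \<Rightarrow> 'a tree" where
  "bst_insert x Leaf = Node Leaf x Leaf"
| "bst_insert x (Node l y r) =
     (if x < y then Node (bst_insert x l) y r else Node l y (bst_insert x r))"

lemma whole_tree_insert_leaf:
  "whole_tree (insert_leaf x (t, ss)) = whole_tree (bst_insert x t, ss)"
  by (induction x t arbitrary: ss rule: bst_insert.induct) auto

lemma set_tree_bst_insert: "set_tree (bst_insert x t) = insert x (set_tree t)"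
  by (induction x t rule: bst_insert.induct) auto

lemma size_bst_insert: "size (bst_insert x t) = Suc (size t)"
  by (induction x t rule: bst_insert.induct) auto

lemma bst_bst_insert: "bst t \<Longrightarrow> x \<notin> set_tree t \<Longrightarrow> bst (bst_insert x t)"
  by (induction x t rule: bst_insert.induct) (auto simp: set_tree_bst_insert)

lemma inorder_insert_zigzag':
  "u \<in> set_pmf (insert_zigzag p x t) \<Longrightarrow> inorder u = inorder (bst_insert x t)"
  by (drule inorder_insert_zigzag) (simp add: whole_tree_insert_leaf)

text \<open>Rotations keep the inorder sequence, and being a search tree, the key set and the size
  depend on that sequence alone. So plain leaf insertion predicts all three, whatever the coins
  show.\<close>

lemma inserts_zigzag_invariant:
  assumes "u \<in> set_pmf (inserts_zigzag p xs t)" "bst t" "distinct xs"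
    "set xs \<inter> set_tree t = {}"
  shows "bst u \<and> size u = size t + length xs"
  using assms
proof (induction xs arbitrary: t)
  case (Cons x xs)
  then obtain v where v: "v \<in> set_pmf (insert_zigzag p x t)"
      "u \<in> set_pmf (inserts_zigzag p xs v)" by auto
  note io = inorder_insert_zigzag'[OF v(1)]
  have set: "set_tree v = insert x (set_tree t)"
    using io by (metis set_inorder set_tree_bst_insert)
  have size: "size v = Suc (size t)"
    using io by (metis length_inorder size_bst_insert)
  have "bst v"
    using io bst_bst_insert[of t x] Cons.prems by (simp add: bst_iff_sorted_wrt_less)
  with Cons.IH[OF v(2)] Cons.prems set size show ?case by auto
qed auto

lemma ipl_le_size_square: "ipl t \<le> size t * size t"
  by (induction t) (auto simp: algebra_simps)

text \<open>A longest path has nodes of depths \<open>0\<close> to \<open>h - 1\<close>, with sum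
  \<open>h * (h - 1) / 2\<close>; adding \<open>h\<close> on the right avoids truncated
  subtraction.\<close>

lemma height_square_le_ipl: "height t * height t \<le> 2 * ipl t + height t"
proof (induction t)
  case (Node l x r)
  \<comment> \<open>Hanging a subtree of height \<open>h\<close> below a new root adds its size, at
    least \<open>h\<close>, to the path length. Doubled, this pays for the growth from
    \<open>h * (h - 1)\<close> to \<open>(h + 1) * h\<close>.\<close>
  have "height l \<le> size l" "height r \<le> size r" by (auto intro: height_le_size_tree)
  with Node show ?case by (cases "height l \<le> height r") (auto simp: max_def)
qed simp

fun left_spine :: "'a tree \<Rightarrow> nat" where
  "left_spine Leaf = 0"
| "left_spine (Node l x r) = Suc (left_spine l)"

lemma left_spine_le_height: "left_spine t \<le> height t"
  by (induction t) auto

section \<open>Trees as right spines\<close>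

text \<open>
  A tree is encoded by the list of the nodes on its right spine, the maximum first, each node
  given by its left subtree and its key.
\<close>

type_synonym 'a spine = "('a tree \<times> 'a) list"

definition spine_path :: "'a spine \<Rightarrow> 'a step list" where
  "spine_path = map (\<lambda>(a, y). RightOf a y)"

lemma spine_path_simps [simp]:
  "spine_path [] = []" "spine_path ((a, y) # cs) = RightOf a y # spine_path cs"
  by (auto simp: spine_path_def)

definition spine_tree :: "'a spine \<Rightarrow> 'a tree" where
  "spine_tree cs = whole_tree (Leaf, spine_path cs)"

text \<open>The list is the path above the node where the climb stops. Its parent \<open>y\<close>
  rotates above its grandparent \<open>z\<close>, so \<open>z\<close> leaves the spine; without a
  grandparent nothing happens.\<close>

fun spine_rotate :: "'a spine \<Rightarrow> 'a spine" where
  "spine_rotate ((a, y) # (b, z) # cs) = (Node b z a, y) # cs"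
| "spine_rotate cs = cs"

fun spine_rebalance :: "real \<Rightarrow> 'a spine \<Rightarrow> 'a spine pmf" where
  "spine_rebalance p [] = return_pmf []"
| "spine_rebalance p (c # cs) = bernoulli_pmf p \<bind>
     (\<lambda>tail. if tail then map_pmf ((#) c) (spine_rebalance p cs)
             else return_pmf (spine_rotate (c # cs)))"

lemma finite_spine_rebalance [simp]: "finite (set_pmf (spine_rebalance p cs))"
  by (induction cs) auto

lemma spine_rebalance_single: "spine_rebalance p [c] = return_pmf [c]"
  by (cases c) (simp cong: if_cong)

lemma whole_tree_zigzag_spine:
  "whole_tree (zigzag (t, spine_path cs)) = whole_tree (t, spine_path (spine_rotate cs))"
proof (cases cs rule: spine_rotate.cases)
  case ("2_2" v)
  then show ?thesis by (cases v; cases t) auto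
qed auto

text \<open>The subtree \<open>t\<close> must be arbitrary in the induction, since each tail absorbs
  one spine node into it.\<close>

lemma rebalance_zigzag_spine:
  "rebalance_zigzag p (t, spine_path cs) =
     map_pmf (\<lambda>ds. whole_tree (t, spine_path ds)) (spine_rebalance p cs)"
proof (induction cs arbitrary: t)
  case Nil
  then show ?case by (cases t) (auto simp: rebalance_zigzag_def)
next
  case (Cons c cs)
  obtain a y where c: "c = (a, y)" by force
  have 1: "map_pmf (\<lambda>w. whole_tree (zigzag w)) (climb p (plug (RightOf a y) t, spine_path cs)) =
    map_pmf (\<lambda>ds. whole_tree (t, spine_path ds)) (map_pmf ((#) c) (spine_rebalance p cs))"
    using Cons.IH[of "plug (RightOf a y) t"]
    by (simp add: rebalance_zigzag_def pmf.map_comp comp_def c)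
  have 2: "whole_tree (zigzag (t, RightOf a y # spine_path cs)) =
      whole_tree (t, spine_path (spine_rotate (c # cs)))"
    using whole_tree_zigzag_spine[of t "c # cs"] by (simp add: c)
  show ?case
    unfolding rebalance_zigzag_def
    using 1 2 by (auto simp: c map_bind_pmf intro!: bind_pmf_cong)
qed

text \<open>A search for a key above all spine keys turns right at each spine node, and so rebuilds
  exactly the path that was plugged.\<close>

lemma insert_leaf_spine:
  assumes "\<And>c. c \<in> set cs \<Longrightarrow> snd c < x"
  shows "insert_leaf x (whole_tree (t, spine_path cs), ss) =
    insert_leaf x (t, spine_path cs @ ss)"
  using assms
proof (induction cs arbitrary: t)
  case (Cons c cs)
  obtain a y where c: "c = (a, y)" by force
  have "y < x" using Cons.prems[of c] by (auto simp: c)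
  with Cons.IH[of "Node a y t"] Cons.prems show ?case by (auto simp: c)
qed simp

lemma insert_zigzag_maximum:
  assumes "\<And>c. c \<in> set cs \<Longrightarrow> snd c < x"
  shows "insert_zigzag p x (spine_tree cs) =
    map_pmf (\<lambda>ds. spine_tree ((Leaf, x) # ds)) (spine_rebalance p cs)"
  using insert_leaf_spine[OF assms, where t = Leaf and ss = "[]"]
  by (simp add: insert_zigzag_def spine_tree_def rebalance_zigzag_spine)

text \<open>The result of the double rotation at the new key \<open>x'\<close>, the left child of the maximum \<open>x\<close>.\<close>

fun spine_zigzag :: "'a \<Rightarrow> 'a \<Rightarrow> 'a spine \<Rightarrow> 'a spine" where
  "spine_zigzag x x' [] = [(Node Leaf x' Leaf, x)]"
| "spine_zigzag x x' ((b, z) # ds) = (Leaf, x) # (Node b z Leaf, x') # ds"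

text \<open>A first tail moves to \<open>x\<close>, itself on the right spine, and the rest is
  ordinary spine rebalancing; a first head triggers the double rotation.\<close>

definition spine_second :: "real \<Rightarrow> 'a \<Rightarrow> 'a \<Rightarrow> 'a spine \<Rightarrow> 'a spine pmf" where
  "spine_second p x x' ds = bernoulli_pmf p \<bind>
     (\<lambda>tail. if tail then map_pmf ((#) (Node Leaf x' Leaf, x)) (spine_rebalance p ds)
             else return_pmf (spine_zigzag x x' ds))"

lemma finite_spine_second [simp]: "finite (set_pmf (spine_second p x x' ds))"
  by (auto simp: spine_second_def)

lemma insert_zigzag_second:
  assumes "\<And>c. c \<in> set ds \<Longrightarrow> snd c < x'" "x' < x"
  shows "insert_zigzag p x' (spine_tree ((Leaf, x) # ds)) =
    map_pmf spine_tree (spine_second p x x' ds)"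
proof -
  let ?t = "Node Leaf x' Leaf"
  have leaf: "insert_leaf x' (spine_tree ((Leaf, x) # ds), []) =
      (?t, LeftOf x Leaf # spine_path ds)"
    using insert_leaf_spine[OF assms(1), where t = "Node Leaf x Leaf" and ss = "[]"] assms(2)
    by (simp add: spine_tree_def)
  have 1: "map_pmf (\<lambda>w. whole_tree (zigzag w)) (climb p (Node ?t x Leaf, spine_path ds)) =
    map_pmf spine_tree (map_pmf ((#) (?t, x)) (spine_rebalance p ds))"
    using rebalance_zigzag_spine[of p "Node ?t x Leaf" ds]
    by (simp add: rebalance_zigzag_def pmf.map_comp comp_def spine_tree_def)
  have 2: "whole_tree (zigzag (?t, LeftOf x Leaf # spine_path ds)) =
      spine_tree (spine_zigzag x x' ds)"
    by (cases "(x, x', ds)" rule: spine_zigzag.cases) (auto simp: spine_tree_def)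
  show ?thesis
    unfolding insert_zigzag_def leaf rebalance_zigzag_def spine_second_def
    using 1 2 by (auto simp: map_bind_pmf intro!: bind_pmf_cong)
qed

lemma length_spine_rotate:
  "length (spine_rotate cs) \<le> length cs" "spine_rotate cs = [] \<longleftrightarrow> cs = []"
  by (cases cs rule: spine_rotate.cases; simp)+

lemma keys_spine_rotate: "snd ` set (spine_rotate cs) \<subseteq> snd ` set cs"
  by (cases cs rule: spine_rotate.cases) auto

lemma spine_rebalance_invariant:
  assumes "ds \<in> set_pmf (spine_rebalance p cs)"
  shows "length ds \<le> length cs \<and> (ds = [] \<longleftrightarrow> cs = []) \<and> snd ` set ds \<subseteq> snd ` set cs"
  using assms
proof (induction cs arbitrary: ds)
  case (Cons c cs)
  then consider es where "es \<in> set_pmf (spine_rebalance p cs)" "ds = c # es"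
    | "ds = spine_rotate (c # cs)" by (auto split: if_splits)
  then show ?case
  proof cases
    case 1
    with Cons.IH[of es] show ?thesis by auto
  next
    case 2
    then show ?thesis
      using length_spine_rotate[of "c # cs"] keys_spine_rotate[of "c # cs"] by auto
  qed
qed auto

lemma spine_second_invariant:
  assumes "es \<in> set_pmf (spine_second p x x' ds)"
  shows "length es \<le> Suc (length ds) \<and> es \<noteq> [] \<and> (ds \<noteq> [] \<longrightarrow> 2 \<le> length es) \<and>
    snd ` set es \<subseteq> {x, x'} \<union> snd ` set ds"
proof -
  from assms consider fs where "fs \<in> set_pmf (spine_rebalance p ds)"
      "es = (Node Leaf x' Leaf, x) # fs"
    | "es = spine_zigzag x x' ds"
    by (auto simp: spine_second_def split: if_splits)
  then show ?thesis
  proof cases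
    case 1
    with spine_rebalance_invariant[OF 1(1)] show ?thesis by (cases fs) auto
  next
    case 2
    then show ?thesis by (cases "(x, x', ds)" rule: spine_zigzag.cases) auto
  qed
qed

section \<open>The pairs sequence\<close>

definition spine_pair :: "real \<Rightarrow> nat \<Rightarrow> nat spine \<Rightarrow> nat spine pmf" where
  "spine_pair p k cs = spine_rebalance p cs \<bind> spine_second p (2 * k + 2) (2 * k + 1)"

fun spine_pairs :: "real \<Rightarrow> nat \<Rightarrow> nat spine pmf" where
  "spine_pairs p 0 = return_pmf []"
| "spine_pairs p (Suc k) = spine_pairs p k \<bind> spine_pair p k"

lemma finite_spine_pair [simp]: "finite (set_pmf (spine_pair p k cs))"
  by (auto simp: spine_pair_def)

lemma finite_spine_pairs [simp]: "finite (set_pmf (spine_pairs p k))"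
  by (induction k) auto

text \<open>The key bound makes the next two keys exceed all spine keys. The lower length bound
  gives, from the second pair on, the two spine nodes that the drift computation needs.\<close>

lemma spine_pairs_invariant:
  assumes "cs \<in> set_pmf (spine_pairs p k)"
  shows "min 2 k \<le> length cs \<and> length cs \<le> k \<and> snd ` set cs \<subseteq> {..2 * k}"
  using assms
proof (induction k arbitrary: cs)
  case (Suc k)
  then obtain bs ds where bs: "bs \<in> set_pmf (spine_pairs p k)"
    and ds: "ds \<in> set_pmf (spine_rebalance p bs)"
    and cs: "cs \<in> set_pmf (spine_second p (2 * k + 2) (2 * k + 1) ds)"
    by (auto simp: spine_pair_def)
  note IH = Suc.IH[OF bs] and 1 = spine_rebalance_invariant[OF ds]
    and 2 = spine_second_invariant[OF cs]
  have "snd ` set cs \<subseteq> {2 * k + 2, 2 * k + 1} \<union> {..2 * k}"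
    using IH 1 2 by blast
  also have "\<dots> \<subseteq> {..2 * Suc k}" by auto
  finally have "snd ` set cs \<subseteq> {..2 * Suc k}" .
  moreover have "min 2 (Suc k) \<le> length cs"
  proof (cases "k = 0")
    case True
    then show ?thesis using 2 by (cases cs) auto
  next
    case False
    then have "bs \<noteq> []" using IH by auto
    then have "2 \<le> length cs" using 1 2 by blast
    then show ?thesis by simp
  qed
  ultimately show ?case using IH 1 2 by simp
qed auto

lemma inserts_zigzag_append:
  "inserts_zigzag p (xs @ ys) t = inserts_zigzag p xs t \<bind> inserts_zigzag p ys"
  by (induction xs arbitrary: t) (auto simp: bind_return_pmf bind_assoc_pmf intro: bind_pmf_cong)

lemma inserts_zigzag_pair:
  "inserts_zigzag p [x, y] t = insert_zigzag p x t \<bind> insert_zigzag p y"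
proof -
  have "inserts_zigzag p [y] = insert_zigzag p y"
  proof
    have Nil: "inserts_zigzag p [] = return_pmf" by (rule ext) simp
    show "inserts_zigzag p [y] t = insert_zigzag p y t" for t
      by (simp only: inserts_zigzag.simps(2) Nil bind_return_pmf')
  qed
  then show ?thesis by simp
qed

lemma pairs_seq_Suc: "pairs_seq (2 * Suc k) = pairs_seq (2 * k) @ [2 * k + 2, 2 * k + 1]"
  by (simp add: pairs_seq_def)

text \<open>The first key of a pair is a new maximum; the second lies between it and all older keys,
  hence becomes its left child. So the spine process describes the whole random tree.\<close>

lemma pairs_tree_eq_spine_pairs: "pairs_tree p (2 * k) = map_pmf spine_tree (spine_pairs p k)"
proof (induction k)
  case 0
  show ?case by (simp add: pairs_tree_def pairs_seq_def spine_tree_def)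
next
  case (Suc k)
  have "inserts_zigzag p [2 * k + 2, 2 * k + 1] (spine_tree cs) =
      map_pmf spine_tree (spine_pair p k cs)" if "cs \<in> set_pmf (spine_pairs p k)" for cs
  proof -
    have keys: "snd ` set cs \<subseteq> {..2 * k}" using spine_pairs_invariant[OF that] by blast
    have max: "insert_zigzag p (2 * k + 2) (spine_tree cs) =
        map_pmf (\<lambda>ds. spine_tree ((Leaf, 2 * k + 2) # ds)) (spine_rebalance p cs)"
      using keys by (intro insert_zigzag_maximum) fastforce
    have "inserts_zigzag p [2 * k + 2, 2 * k + 1] (spine_tree cs) = spine_rebalance p cs \<bind>
        (\<lambda>ds. insert_zigzag p (2 * k + 1) (spine_tree ((Leaf, 2 * k + 2) # ds)))"
      unfolding inserts_zigzag_pair max bind_map_pmf ..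
    also have "\<dots> = spine_rebalance p cs \<bind>
        (\<lambda>ds. map_pmf spine_tree (spine_second p (2 * k + 2) (2 * k + 1) ds))"
    proof (intro bind_pmf_cong refl insert_zigzag_second)
      fix ds c assume "ds \<in> set_pmf (spine_rebalance p cs)" "c \<in> set ds"
      with spine_rebalance_invariant[of ds p cs] keys show "snd c < 2 * k + 1" by fastforce
    qed auto
    finally show ?thesis by (simp add: spine_pair_def map_bind_pmf)
  qed
  then show ?case
    using Suc unfolding pairs_tree_def pairs_seq_Suc inserts_zigzag_append
    by (auto simp: bind_map_pmf map_bind_pmf simp del: inserts_zigzag.simps intro!: bind_pmf_cong)
qed

lemma pairs_seq_properties:
  "distinct (pairs_seq (2 * k)) \<and> length (pairs_seq (2 * k)) = 2 * k \<and>
   set (pairs_seq (2 * k)) \<subseteq> {..2 * k}"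
proof (induction k)
  case (Suc k)
  then show ?case unfolding pairs_seq_Suc by fastforce
qed (simp add: pairs_seq_def)

lemma pairs_tree_bst_size:
  assumes "t \<in> set_pmf (pairs_tree p (2 * k))"
  shows "bst t" "size t = 2 * k"
  using inserts_zigzag_invariant[of t p "pairs_seq (2 * k)" Leaf] assms pairs_seq_properties[of k]
  by (auto simp: pairs_tree_def)

section \<open>The potential\<close>

text \<open>The last entry of the list is the root, so this measures the left spine of the root's
  left subtree.\<close>

fun left_height :: "'a spine \<Rightarrow> nat" where
  "left_height [] = 0"
| "left_height [(a, y)] = left_spine a"
| "left_height (c # cs) = left_height cs"

lemma left_height_Cons [simp]: "cs \<noteq> [] \<Longrightarrow> left_height (c # cs) = left_height cs"
  by (cases cs) auto

lemma spine_height_bounds: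
  "left_height cs \<le> height (whole_tree (t, spine_path cs))"
  "length cs + height t \<le> height (whole_tree (t, spine_path cs))"
proof (induction cs arbitrary: t rule: left_height.induct)
  case (2 a y)
  { case 1 show ?case using left_spine_le_height[of a] by simp }
  { case 2 show ?case by simp }
next
  case (3 c d cs)
  obtain a y where c: "c = (a, y)" by force
  { case 1 show ?case using "3.IH"(1)[of "Node a y t"] by (simp add: c) }
  { case 2 show ?case using "3.IH"(2)[of "Node a y t"] by (simp add: c) }
qed auto

definition potential :: "real \<Rightarrow> 'a spine \<Rightarrow> real" where
  "potential p cs = p * real (left_height cs) - (1 - p) * real (length cs)"

lemma potential_Cons: "cs \<noteq> [] \<Longrightarrow> potential p (c # cs) = potential p cs - (1 - p)"
  by (simp add: potential_def algebra_simps)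

text \<open>
  A rotation at depth at least 3 shortens the right spine, gaining \<open>1 - p\<close>; one at depth 2 also
  lengthens the left spine, gaining 1. The weights are such that the expected gain does not depend
  on the length of the spine.
\<close>

lemma expectation_potential_rebalance:
  assumes p: "0 \<le> p" "p \<le> 1" and "2 \<le> length cs"
  shows "measure_pmf.expectation (spine_rebalance p cs) (potential p) = potential p cs + (1 - p)"
  using assms(3)
proof (induction cs)
  case (Cons c cs)
  obtain a y where c: "c = (a, y)" by force
  have ne: "cs \<noteq> []" using Cons.prems by auto
  have "measure_pmf.expectation (spine_rebalance p cs) (\<lambda>ds. potential p (c # ds)) =
      measure_pmf.expectation (spine_rebalance p cs) (\<lambda>ds. potential p ds + - (1 - p))"
    using spine_rebalance_invariant[of _ p cs] ne
    by (intro integral_cong_AE) (auto simp: AE_measure_pmf_iff potential_Cons)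
  also have "\<dots> = measure_pmf.expectation (spine_rebalance p cs) (potential p) - (1 - p)"
    by (subst expectation_add_const) auto
  finally have E: "measure_pmf.expectation (spine_rebalance p (c # cs)) (potential p) =
      p * (measure_pmf.expectation (spine_rebalance p cs) (potential p) - (1 - p)) +
      (1 - p) * potential p (spine_rotate (c # cs))"
    using p by (simp add: expectation_coin)
  obtain b z ds where cs: "cs = (b, z) # ds" using ne by (cases cs) auto
  show ?case
  proof (cases "ds = []")
    \<comment> \<open>With two spine nodes, a head rotates at the root and gains \<open>1\<close>,
      with probability \<open>1 - p\<close>; a tail gains nothing.\<close>
    case True
    then show ?thesis
      unfolding E unfolding cs True spine_rebalance_single
      by (simp add: c potential_def algebra_simps)
  next
    \<comment> \<open>On a longer spine a head gains \<open>1 - p\<close> at once, and a tail gains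
      \<open>1 - p\<close> in expectation by induction.\<close>
    case False
    then have "2 \<le> length cs" by (cases ds) (auto simp: cs)
    from Cons.IH[OF this] show ?thesis unfolding E
      using False by (simp add: c cs potential_Cons) (simp add: algebra_simps)
  qed
qed simp

text \<open>The new spine node costs \<open>1 - p\<close>. If \<open>ds\<close> is a single node, a
  head extends the left spine and gains \<open>p\<close>, and a tail gains nothing. Otherwise the
  double rotation is neutral, and a tail gains \<open>1 - p\<close> in expectation. Both cases
  average to \<open>p * (1 - p)\<close>.\<close>

lemma expectation_potential_second:
  assumes p: "0 \<le> p" "p \<le> 1" and ne: "ds \<noteq> []"
  shows "measure_pmf.expectation (spine_second p x x' ds) (potential p) =
    potential p ds - (1 - p) + p * (1 - p)"
proof -
  have "measure_pmf.expectation (spine_rebalance p ds)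
        (\<lambda>es. potential p ((Node Leaf x' Leaf, x) # es)) =
      measure_pmf.expectation (spine_rebalance p ds) (\<lambda>es. potential p es + - (1 - p))"
    using spine_rebalance_invariant[of _ p ds] ne
    by (intro integral_cong_AE) (auto simp: AE_measure_pmf_iff potential_Cons)
  also have "\<dots> = measure_pmf.expectation (spine_rebalance p ds) (potential p) - (1 - p)"
    by (subst expectation_add_const) auto
  finally have E: "measure_pmf.expectation (spine_second p x x' ds) (potential p) =
      p * (measure_pmf.expectation (spine_rebalance p ds) (potential p) - (1 - p)) +
      (1 - p) * potential p (spine_zigzag x x' ds)"
    using p by (simp add: spine_second_def expectation_coin)
  obtain b z es where ds: "ds = (b, z) # es" using ne by (cases ds) auto
  show ?thesis
  proof (cases "es = []")
    case True
    then show ?thesis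
      unfolding E unfolding ds True spine_rebalance_single
      by (simp add: potential_def algebra_simps)
  next
    case False
    then have "2 \<le> length ds" by (cases es) (auto simp: ds)
    from expectation_potential_rebalance[OF p this] show ?thesis unfolding E
      using False by (simp add: ds potential_Cons) (simp add: algebra_simps)
  qed
qed

text \<open>The first rebalancing gains in expectation exactly the \<open>1 - p\<close> that the new
  spine node costs, so the \<open>p * (1 - p)\<close> of the second insertion remains.\<close>

lemma expectation_potential_pair:
  assumes p: "0 \<le> p" "p \<le> 1" and len: "2 \<le> length cs"
  shows "potential p cs + p * (1 - p) \<le>
    measure_pmf.expectation (spine_pair p k cs) (potential p)"
proof -
  have "potential p cs + p * (1 - p) =
      measure_pmf.expectation (spine_rebalance p cs) (\<lambda>ds. potential p ds + (p * (1 - p) - (1 - p)))"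
    by (subst expectation_add_const) (auto simp: expectation_potential_rebalance[OF p len])
  also have "\<dots> \<le> measure_pmf.expectation (spine_pair p k cs) (potential p)"
    unfolding spine_pair_def
  proof (rule expectation_bind_ge)
    fix ds assume "ds \<in> set_pmf (spine_rebalance p cs)"
    with spine_rebalance_invariant[of ds p cs] len have "ds \<noteq> []" by auto
    then show "potential p ds + (p * (1 - p) - (1 - p)) \<le>
        measure_pmf.expectation (spine_second p (2 * k + 2) (2 * k + 1) ds) (potential p)"
      by (subst expectation_potential_second[OF p]) auto
  qed auto
  finally show ?thesis .
qed

lemma expectation_potential_pairs:
  assumes p: "0 \<le> p" "p \<le> 1"
  shows "p * (1 - p) * real k - 2 \<le>
    measure_pmf.expectation (spine_pairs p (k + 2)) (potential p)"
proof (induction k)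
  case 0
  have "-2 \<le> potential p cs" if "cs \<in> set_pmf (spine_pairs p 2)" for cs
  proof -
    \<comment> \<open>After two pairs the spine has at most two nodes; this is the source of the
      constant \<open>2\<close>.\<close>
    have "(1 - p) * real (length cs) \<le> 1 * 2"
      using spine_pairs_invariant[OF that] p by (intro mult_mono) auto
    moreover have "0 \<le> p * real (left_height cs)" using p by simp
    ultimately show ?thesis by (simp add: potential_def)
  qed
  then have "-2 \<le> measure_pmf.expectation (spine_pairs p 2) (potential p)"
    by (intro expectation_ge_const) auto
  then show ?case by (simp add: numeral_2_eq_2)
next
  case (Suc k)
  have "p * (1 - p) * real (Suc k) - 2 \<le>
      measure_pmf.expectation (spine_pairs p (k + 2)) (potential p) + p * (1 - p)"
    using Suc by (simp add: algebra_simps)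
  also have "\<dots> = measure_pmf.expectation (spine_pairs p (k + 2))
      (\<lambda>cs. potential p cs + p * (1 - p))"
    by (rule expectation_add_const[symmetric]) (rule finite_spine_pairs)
  also have "\<dots> \<le> measure_pmf.expectation (spine_pairs p (k + 2) \<bind> spine_pair p (k + 2))
      (potential p)"
  proof (rule expectation_bind_ge)
    fix cs assume "cs \<in> set_pmf (spine_pairs p (k + 2))"
    from spine_pairs_invariant[OF this] show "potential p cs + p * (1 - p) \<le>
      measure_pmf.expectation (spine_pair p (k + 2) cs) (potential p)"
      by (intro expectation_potential_pair p) auto
  qed (auto simp del: spine_pairs.simps)
  finally show ?case by simp
qed

section \<open>Linear expected height\<close>

lemma bernoulli_pmf_0: "bernoulli_pmf 0 = return_pmf False"
proof (rule pmf_eqI)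
  show "pmf (bernoulli_pmf 0) b = pmf (return_pmf False) b" for b by (cases b) auto
qed

lemma bernoulli_pmf_1: "bernoulli_pmf 1 = return_pmf True"
proof (rule pmf_eqI)
  show "pmf (bernoulli_pmf 1) b = pmf (return_pmf True) b" for b by (cases b) auto
qed

lemma spine_rebalance_0: "spine_rebalance 0 cs = return_pmf (spine_rotate cs)"
  by (cases cs) (auto simp: bernoulli_pmf_0 bind_return_pmf)

lemma spine_rebalance_1: "spine_rebalance 1 cs = return_pmf cs"
  by (induction cs) (auto simp: bernoulli_pmf_1 bind_return_pmf)

text \<open>With heads only, each pair rotates the maximum above the root and then lifts the new
  smaller key above it. Two spine nodes remain and the left spine gains two nodes, more than the
  bound claims.\<close>

lemma spine_pairs_0:
  assumes "cs \<in> set_pmf (spine_pairs 0 (k + 2))"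
  shows "length cs = 2 \<and> k \<le> left_height cs"
  using assms
proof (induction k arbitrary: cs)
  case 0
  with spine_pairs_invariant[of cs 0 2] show ?case by (auto simp: numeral_2_eq_2)
next
  case (Suc k)
  then obtain bs where bs: "bs \<in> set_pmf (spine_pairs 0 (k + 2))"
    and cs: "cs \<in> set_pmf (spine_pair 0 (k + 2) bs)" by auto
  obtain a y b z where "bs = [(a, y), (b, z)]"
    using Suc.IH[OF bs] by (auto simp: numeral_2_eq_2 length_Suc_conv)
  with Suc.IH[OF bs] cs show ?case
    by (auto simp: spine_pair_def spine_second_def spine_rebalance_0 bernoulli_pmf_0
        bind_return_pmf)
qed

text \<open>With tails only, every climb ends at the root without a rotation, and each pair leaves
  one more node on the right spine.\<close>

lemma spine_pairs_1:
  assumes "cs \<in> set_pmf (spine_pairs 1 k)"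
  shows "length cs = k"
  using assms
proof (induction k arbitrary: cs)
  case (Suc k)
  then obtain bs where "bs \<in> set_pmf (spine_pairs 1 k)" "cs \<in> set_pmf (spine_pair 1 k bs)"
    by auto
  with Suc.IH[of bs] show ?case
    by (auto simp: spine_pair_def spine_second_def spine_rebalance_1 bernoulli_pmf_1
        bind_return_pmf)
qed simp

lemma expectation_height_ge:
  assumes p: "0 \<le> p" "p \<le> 1"
  shows "\<exists>c>0. \<forall>k. c * real k - 2 \<le>
    measure_pmf.expectation (pairs_tree p (2 * (k + 2))) (\<lambda>t. real (height t))"
proof -
  have E: "measure_pmf.expectation (pairs_tree p (2 * (k + 2))) (\<lambda>t. real (height t)) =
      measure_pmf.expectation (spine_pairs p (k + 2)) (\<lambda>cs. real (height (spine_tree cs)))" for k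
    by (simp only: pairs_tree_eq_spine_pairs integral_map_pmf)
  have h1: "left_height cs \<le> height (spine_tree cs)" for cs :: "nat spine"
    unfolding spine_tree_def by (rule spine_height_bounds)
  have h2: "length cs \<le> height (spine_tree cs)" for cs :: "nat spine"
    using spine_height_bounds(2)[of cs Leaf] by (simp add: spine_tree_def)
  \<comment> \<open>The drift \<open>p * (1 - p)\<close> vanishes at both ends, so these need their
    own argument.\<close>
  consider "p = 0" | "p = 1" | "0 < p" "p < 1" using p by linarith
  then show ?thesis
  proof cases
    case 1
    have "1 * real k - 2 \<le>
        measure_pmf.expectation (spine_pairs p (k + 2)) (\<lambda>cs. real (height (spine_tree cs)))" for k
    proof (rule expectation_ge_const[OF finite_spine_pairs])
      fix cs assume "cs \<in> set_pmf (spine_pairs p (k + 2))"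
      then show "1 * real k - 2 \<le> real (height (spine_tree cs))"
        using spine_pairs_0[of cs k] h1[of cs] 1 by simp
    qed
    then show ?thesis unfolding E by (intro exI[of _ 1]) simp
  next
    case 2
    have "1 * real k - 2 \<le>
        measure_pmf.expectation (spine_pairs p (k + 2)) (\<lambda>cs. real (height (spine_tree cs)))" for k
    proof (rule expectation_ge_const[OF finite_spine_pairs])
      fix cs assume "cs \<in> set_pmf (spine_pairs p (k + 2))"
      then show "1 * real k - 2 \<le> real (height (spine_tree cs))"
        using spine_pairs_1[of cs "k + 2"] h2[of cs] 2 by simp
    qed
    then show ?thesis unfolding E by (intro exI[of _ 1]) simp
  next
    case 3
    have "p * (1 - p) * real k - 2 \<le>
        measure_pmf.expectation (spine_pairs p (k + 2)) (\<lambda>cs. real (height (spine_tree cs)))" for k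
    proof -
      have "potential p cs \<le> real (height (spine_tree cs))" for cs :: "nat spine"
      proof -
        have "potential p cs \<le> p * real (left_height cs)" using p by (simp add: potential_def)
        also have "\<dots> \<le> 1 * real (left_height cs)" using p by (intro mult_right_mono) auto
        finally show ?thesis using h1[of cs] by simp
      qed
      then show ?thesis
        by (intro order_trans[OF expectation_potential_pairs[OF p]] expectation_mono_finite
            finite_spine_pairs)
    qed
    then show ?thesis unfolding E using 3 by (intro exI[of _ "p * (1 - p)"]) simp
  qed
qed

section \<open>From expected height to expected average depth\<close>

lemma finite_pairs_tree: "finite (set_pmf (pairs_tree p (2 * k)))"
  by (simp add: pairs_tree_eq_spine_pairs)

lemma expectation_avg_depth_ge:
  assumes "measure_pmf.expectation (pairs_tree p (2 * k)) (\<lambda>t. real (height t)) \<ge> a"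
    and "1 \<le> a" "0 < k"
  shows "(a\<^sup>2 - a) / (4 * real k) \<le> measure_pmf.expectation (pairs_tree p (2 * k)) avg_depth"
proof -
  let ?E = "measure_pmf.expectation (pairs_tree p (2 * k))"
  have "((2 * a - 1) * real (height t) - a\<^sup>2) / (4 * real k) \<le> avg_depth t"
    if "t \<in> set_pmf (pairs_tree p (2 * k))" for t
  proof -
    let ?h = "real (height t)"
    have "?h * ?h \<le> 2 * real (ipl t) + ?h"
      using height_square_le_ipl[of t] by (metis of_nat_add of_nat_le_iff of_nat_mult of_nat_numeral)
    \<comment> \<open>This puts the tangent at \<open>a\<close> below the square of the height. The
      resulting bound is linear in the height, so its expectation needs only the expected
      height.\<close>
    moreover have "0 \<le> (?h - a)\<^sup>2" by simp
    ultimately have "(2 * a - 1) * ?h - a\<^sup>2 \<le> 2 * real (ipl t)"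
      by (simp add: power2_eq_square algebra_simps)
    then have "((2 * a - 1) * ?h - a\<^sup>2) / (4 * real k) \<le> 2 * real (ipl t) / (4 * real k)"
      by (intro divide_right_mono) auto
    also have "\<dots> = avg_depth t"
      using pairs_tree_bst_size(2)[OF that] by (simp add: avg_depth_def sum_list_depths)
    finally show ?thesis .
  qed
  then have "?E (\<lambda>t. ((2 * a - 1) * real (height t) - a\<^sup>2) / (4 * real k)) \<le> ?E avg_depth"
    by (intro expectation_mono_finite finite_pairs_tree)
  also have "?E (\<lambda>t. ((2 * a - 1) * real (height t) - a\<^sup>2) / (4 * real k)) =
      ((2 * a - 1) * ?E (\<lambda>t. real (height t)) - a\<^sup>2) / (4 * real k)"
    using expectation_add_const[OF finite_pairs_tree, where c = "- a\<^sup>2"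
        and h = "\<lambda>t. (2 * a - 1) * real (height t)"] by simp
  finally have 1: "((2 * a - 1) * ?E (\<lambda>t. real (height t)) - a\<^sup>2) / (4 * real k) \<le> ?E avg_depth" .
  have "(2 * a - 1) * a \<le> (2 * a - 1) * ?E (\<lambda>t. real (height t))"
    using assms by (intro mult_left_mono) auto
  then have "a\<^sup>2 - a \<le> (2 * a - 1) * ?E (\<lambda>t. real (height t)) - a\<^sup>2"
    by (simp add: power2_eq_square algebra_simps)
  then have "(a\<^sup>2 - a) / (4 * real k) \<le>
      ((2 * a - 1) * ?E (\<lambda>t. real (height t)) - a\<^sup>2) / (4 * real k)"
    by (intro divide_right_mono) auto
  with 1 show ?thesis by linarith
qed

lemma avg_depth_bounds: "0 \<le> avg_depth t" "avg_depth t \<le> real (size t)"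
proof -
  show "0 \<le> avg_depth t" by (simp add: avg_depth_def)
  have "real (ipl t) \<le> real (size t) * real (size t)"
    using ipl_le_size_square[of t] by (metis of_nat_le_iff of_nat_mult)
  then show "avg_depth t \<le> real (size t)"
    by (cases "size t = 0") (auto simp: avg_depth_def sum_list_depths divide_le_eq)
qed

section \<open>Matching linear bounds along the even lengths\<close>

theorem theorem7:
  fixes p :: real
  assumes "0 \<le> p" and "p \<le> 1"
  shows "(\<forall>n. even n \<longrightarrow> (\<forall>t \<in> set_pmf (pairs_tree p n). bst t)) \<and>
    (\<lambda>n. measure_pmf.expectation (pairs_tree p n) avg_depth)
      \<in> \<Theta>[inf at_top (principal {n. even n})](\<lambda>n. real n)"
proof
  show "\<forall>n. even n \<longrightarrow> (\<forall>t \<in> set_pmf (pairs_tree p n). bst t)"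
    using pairs_tree_bst_size(1) by (auto elim!: evenE)
next
  let ?F = "inf at_top (principal {n::nat. even n})"
  let ?E = "\<lambda>n. measure_pmf.expectation (pairs_tree p n) avg_depth"
  have nonneg: "0 \<le> ?E n" for n
    by (intro integral_nonneg_AE) (simp add: avg_depth_bounds)
  have "?E n \<le> real n" if n: "even n" for n
  proof -
    obtain k where k: "n = 2 * k" using n by (blast elim: evenE)
    have "?E n \<le> measure_pmf.expectation (pairs_tree p n) (\<lambda>_. real n)"
      unfolding k
    proof (rule expectation_mono_finite[OF finite_pairs_tree])
      fix t assume "t \<in> set_pmf (pairs_tree p (2 * k))"
      then show "avg_depth t \<le> real (2 * k)"
        using avg_depth_bounds(2)[of t] pairs_tree_bst_size(2)[of t p k] by simp
    qed
    then show ?thesis by simp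
  qed
  then have upper: "?E \<in> O[?F](\<lambda>n. real n)"
    using nonneg by (intro bigoI[where c = 1]) (auto simp: eventually_inf_principal)
  obtain c where c: "0 < c" and height: "\<And>k. c * real k - 2 \<le>
      measure_pmf.expectation (pairs_tree p (2 * (k + 2))) (\<lambda>t. real (height t))"
    using expectation_height_ge[OF assms] by blast
  have "\<forall>\<^sub>F n in at_top. even n \<longrightarrow> c\<^sup>2 / 64 * real n \<le> ?E n"
  proof -
    \<comment> \<open>Multiplied by \<open>c\<close>, this gives \<open>c * j\<close> at least
      \<open>16 + 16 * c\<close>, enough slack to absorb the shift by two pairs and the constant
      \<open>2\<close>.\<close>
    obtain K where K: "16 / c + 16 \<le> real K" using real_arch_simple by blast
    have "c\<^sup>2 / 64 * real n \<le> ?E n" if n: "2 * K \<le> n" "even n" for n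
    proof -
      obtain j where j: "n = 2 * j" using n by (blast elim: evenE)
      have "0 < 16 / c" using c by simp
      moreover have "real K \<le> real j" using n(1) by (simp add: j)
      ultimately have big: "16 / c + 16 \<le> real j" "16 \<le> real j" using K by linarith+
      define k where "k = j - 2"
      have k: "j = k + 2" using big by (simp add: k_def)
      \<comment> \<open>Half of \<open>c * j\<close> lies below \<open>c * k - 2\<close> and is at
        least \<open>8\<close>, so \<open>a\<close> is at most half of its square. Dividing half of
        the square by \<open>4 * j\<close> leaves \<open>c * c * j / 32\<close>, which is the
        constant \<open>1 / 64\<close> in terms of \<open>n = 2 * j\<close>.\<close>
      define a where "a = c * real j / 2"
      have cj: "16 \<le> c * real j - 16 * c"
        using big c by (simp add: field_simps)
      have a8: "8 \<le> a" using cj c by (simp add: a_def)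
      have "a \<le> c * real k - 2" using cj c by (simp add: a_def k field_simps)
      then have "(a\<^sup>2 - a) / (4 * real j) \<le> ?E n"
        using expectation_avg_depth_ge[of a p j] height[of k] a8 big by (simp add: j k)
      moreover have "c\<^sup>2 / 64 * real n \<le> (a\<^sup>2 - a) / (4 * real j)"
      proof -
        have "a * 2 \<le> a * a" using a8 by (intro mult_left_mono) auto
        then have "a\<^sup>2 / 2 \<le> a\<^sup>2 - a" by (simp add: power2_eq_square)
        then have "a\<^sup>2 / 2 / (4 * real j) \<le> (a\<^sup>2 - a) / (4 * real j)"
          by (intro divide_right_mono) auto
        moreover have "a\<^sup>2 / 2 / (4 * real j) = c\<^sup>2 / 64 * real n"
          using big by (simp add: a_def j power2_eq_square field_simps)
        ultimately show ?thesis by linarith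
      qed
      ultimately show ?thesis by linarith
    qed
    then show ?thesis by (auto simp: eventually_at_top_linorder)
  qed
  then have "\<forall>\<^sub>F n in ?F. norm (real n) \<le> 64 / c\<^sup>2 * norm (?E n)"
    using c nonneg by (auto simp: eventually_inf_principal field_simps elim!: eventually_mono)
  then have "(\<lambda>n. real n) \<in> O[?F](?E)" by (rule bigoI)
  with upper show "?E \<in> \<Theta>[?F](\<lambda>n. real n)"
    by (simp add: bigtheta_def bigomega_iff_bigo)
qed

end
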